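(* Let $\underline R$ be a commutative square ring. A map $f:M\to N$ between two $\underline R$-BHP-modules is $\underline R$-BHP-quadratic if and only if it satisfies the following properties: (1) the maps $M\to N$, $m\mapsto[f(m),n]\cdot x$, are $\underline R$-linear for all $n\in f(M)$ and $x\in R_{ee}$; (2) the additive defect $d_f$ is $\underline R$-bilinear; (3) the scalar defects satisfy $f_{(r)}(m\cdot s)=f_{(r)}(m)\cdot s^2$ for all $m\in M$, $r,s\in R_e$; (4) $f_{(r)}([M])=0$ for all $r\in R_e$, where $[M]$ is the $\underline R$-BHP-submodule of $M$ generated by all $[m,n]\cdot x$ with $m,n\in M$, $x\in R_{ee}$.
   Context: A square ring $\underline R=(R_e\xrightarrow{H}R_{ee}\xrightarrow{P}R_e)$ consists of: a set $R_e$ with a group structure $+$ (not necessarily commutative) and an associative unital multiplication satisfying $r(s+t)=rs+rt$ (the law $(r+s)t=rt+st$ is not required); an abelian group $R_{ee}$; a map $R_e\times R_e\times R_{ee}\times R_e\to R_{ee}$, $(r,s,x,t)\mapsto(r,s)\cdot x\cdot t$, additive in each of its four variables and defining commuting actions on $R_{ee}$ of the multiplicative monoids $R_e\times R_e$ (on the left) and $R_e$ (on the right) (write $(r,s)\cdot x$ if $t=1$ and $x\cdot t$ if $r=s=1$); a group homomorphism $T:R_{ee}\to R_{ee}$ with $T^2=\mathrm{Id}$; a map $H:R_e\to R_{ee}$ and a group homomorphism $P:R_{ee}\to R_e$; such that for all $r,s,t\in R_e$, $x,y\in R_{ee}$: $PHP=P+P$; $P((r,r)\cdot x\cdot s)=rP(x)s$;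 $T=HP-\mathrm{Id}$; $PT=P$; $(P(x),r)\cdot y=(r,P(x))\cdot y=0=y\cdot P(x)$; $H(r+s)=H(r)+H(s)+(s,r)\cdot H(2)$ where $2=1+1$; $H(rs)=(r,r)\cdot H(s)+H(r)\cdot s$; $(r+s)t=rt+st+P((r,s)\cdot H(t))$; $T((r,s)\cdot x\cdot t)=(s,r)\cdot T(x)\cdot t$. The quotient $\overline R=R_e/\operatorname{Im}P$ is a ring. $\underline R$ is commutative if $\overline R$ is commutative and $(r,1)\cdot x=(1,r)\cdot x=x\cdot r$ for all $r\in R_e$, $x\in R_{ee}$. A (right) $\underline R$-BHP-module is a group $M$ (written additively, not necessarily commutative) with operations $M\times R_e\to M$, $(m,r)\mapsto m\cdot r$ and $M\times M\times R_{ee}\to M$, $(m,n,x)\mapsto[m,n]\cdot x$ such that: $m\cdot1=m$, $(m\cdot r)\cdot s=m\cdot(rs)$, $m\cdot(r+s)=m\cdot r+m\cdot s$; $(m+n)\cdot r=m\cdot r+n\cdot r+[m,n]\cdot H(r)$; $m\cdot P(x)=[m,m]\cdot x$; $[m,n]\cdot T(x)=[n,m]\cdot x$; $[m,n]\cdot x$ is additive in each of $m,n,x$; $([m\cdot r,n\cdot s]\cdot x)\cdot t=[m,n]\cdot((r,s)\cdot x\cdot t)$; $[[m,m']\cdot x,n]\cdot y=0$. A BHP-submodule is a subgroup stable under the operations of $R_e$ and $R_{ee}$. A map between BHP-modules is $\underline R$-linear if it is additive and commutes with the operations $\cdot r$ ($r\in R_e$) and $[-,-]\cdot x$ ($x\in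 R_{ee}$); a map $M\times M\to N$ is $\underline R$-bilinear if it is $\underline R$-linear in each variable separately. For a map $f:M\to N$ of BHP-modules put $d_f(m,m')=f(m+m')-f(m')-f(m)$; $f_{(r)}(m)=f(m\cdot r)-f(m)\cdot r$ for $r\in R_e$; $f_{[x]}(m,m')=f([m,m']\cdot x)-[f(m),f(m')]\cdot x$ for $x\in R_{ee}$. For a map $g$ from a set to a BHP-module $N$, $\operatorname{Im}_{\underline R}g$ is the BHP-submodule of $N$ generated by the image of $g$. An element $u$ of a BHP-module $L$ is $\underline R$-central in $L$ if $[u,v]\cdot x=0$ for all $v\in L$, $x\in R_{ee}$. For $\underline R$ commutative, a map $f:M\to N$ is $\underline R$-BHP-quadratic if: (i) $\operatorname{Im}_{\underline R}d_f$, $\operatorname{Im}_{\underline R}f_{(r)}$ and $\operatorname{Im}_{\underline R}f_{[x]}$ consist of elements $\underline R$-central in $\operatorname{Im}_{\underline R}f$, for all $r\in R_e$, $x\in R_{ee}$; (ii) $d_f$ and all $f_{[x]}$ are $\underline R$-bilinear; (iii) $f_{(r)}(m\cdot s)=f_{(r)}(m)\cdot s^2$ for all $m\in M$, $r,s\in R_e$. *)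

theory Defs
  imports "HOL-Algebra.QuotRing"
begin

text \<open>
  Additively written, possibly non-commutative groups are types of class \<open>group_add\<close>, where
  \<open>a - b - c\<close> is \<open>a + (- b) + (- c)\<close>. The term \<open>act r s x t\<close> stands for \<open>(r,s) \<cdot> x \<cdot> t\<close>;
  \<open>act r s x 1\<close> and \<open>act 1 1 x t\<close> are the one-sided actions.
\<close>

locale square_ring =
  fixes act :: "'e::{group_add, monoid_mult} \<Rightarrow> 'e \<Rightarrow> 'ee::ab_group_add \<Rightarrow> 'e \<Rightarrow> 'ee"
    and T :: "'ee \<Rightarrow> 'ee"
    and H :: "'e \<Rightarrow> 'ee"
    and P :: "'ee \<Rightarrow> 'e"
  assumes mult_add_right: "r * (s + t) = r * s + r * t"
    and act_add1: "act (r + r') s x t = act r s x t + act r' s x t"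
    and act_add2: "act r (s + s') x t = act r s x t + act r s' x t"
    and act_add3: "act r s (x + x') t = act r s x t + act r s x' t"
    and act_add4: "act r s x (t + t') = act r s x t + act r s x t'"
    and act_one: "act 1 1 x 1 = x"
    and act_act_left: "act r s (act r' s' x 1) 1 = act (r * r') (s * s') x 1"
    and act_act_right: "act 1 1 (act 1 1 x t) t' = act 1 1 x (t * t')"
    and act_left_right: "act 1 1 (act r s x 1) t = act r s x t"
    and act_right_left: "act r s (act 1 1 x t) 1 = act r s x t"
    and T_add: "T (x + y) = T x + T y"
    and T_T: "T (T x) = x"
    and P_add: "P (x + y) = P x + P y"
    and P_H_P: "P (H (P x)) = P x + P x"
    and P_act: "P (act r r x s) = r * P x * s"
    and T_eq: "T x = H (P x) - x"
    and P_T: "P (T x) = P x"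
    and act_P_left1: "act (P x) r y 1 = 0"
    and act_P_left2: "act r (P x) y 1 = 0"
    and act_P_right: "act 1 1 y (P x) = 0"
    and H_add: "H (r + s) = H r + H s + act s r (H (1 + 1)) 1"
    and H_mult: "H (r * s) = act r r (H s) 1 + act 1 1 (H r) s"
    and mult_add_left: "(r + s) * t = r * t + s * t + P (act r s (H t) 1)"
    and T_act: "T (act r s x t) = act s r (T x) t"
begin

text \<open>The underlying set of \<open>R\<^sub>e\<close> with its two operations; in general it is not a ring.\<close>

definition Re :: "'e ring"
  where "Re = \<lparr>carrier = UNIV, monoid.mult = (*), one = 1, zero = 0, add = (+)\<rparr>"

definition Rbar :: "'e set ring"
  where "Rbar = Re Quot (range P)"

lemma P_0 [simp]: "P 0 = 0"
  using P_add[of 0 0] add_left_imp_eq[of "P 0" "P 0" 0] by simp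

lemma P_minus: "P (- x) = - P x"
  using P_add[of x "- x"] by (simp add: eq_neg_iff_add_eq_0 P_add[symmetric])

lemma double_mult: "(r::'e) * (1 + 1) = r + r"
  by (simp add: mult_add_right)

lemma P_central: "P x + s = s + P x"
proof -
  have z: "act (P x) s (H (1 + 1)) 1 = 0"
    by (rule act_P_left1)
  have "(P x + s) + (P x + s) = (P x + P x) + (s + s)"
    using mult_add_left[of "P x" s "1 + 1"] by (simp add: double_mult z)
  hence "P x + (s + (P x + s)) = P x + (P x + (s + s))"
    by (simp only: add.assoc)
  hence "s + (P x + s) = P x + (s + s)"
    by (rule add_left_imp_eq)
  hence "(s + P x) + s = (P x + s) + s"
    by (simp only: add.assoc)
  thus ?thesis
    by (rule add_right_imp_eq[THEN sym])
qed

lemma add_swap: "s + r = r + s + P (act r s (H (1 + 1)) 1)"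
proof -
  let ?p = "P (act r s (H (1 + 1)) 1)"
  have "(r + s) + (r + s) = (r + r) + (s + s) + ?p"
    using mult_add_left[of r s "1 + 1"] by (simp add: double_mult)
  hence "r + (s + (r + s)) = r + (r + (s + (s + ?p)))"
    by (simp only: add.assoc)
  hence "s + (r + s) = r + (s + (s + ?p))"
    by (rule add_left_imp_eq)
  also have "s + ?p = ?p + s"
    by (rule P_central[symmetric])
  finally have "(s + r) + s = (r + s + ?p) + s"
    by (simp only: add.assoc)
  thus ?thesis
    by (rule add_right_imp_eq)
qed

definition cls :: "'e \<Rightarrow> 'e set"
  where "cls r = range (\<lambda>x. P x + r)"

lemma cls_eq_iff: "cls r = cls s \<longleftrightarrow> (\<exists>x. r = P x + s)"
proof
  assume "cls r = cls s"
  moreover have "r \<in> cls r"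
    unfolding cls_def by (rule range_eqI[of _ _ 0]) simp
  ultimately show "\<exists>x. r = P x + s"
    unfolding cls_def by auto
next
  assume "\<exists>x. r = P x + s"
  then obtain y where y: "r = P y + s" by blast
  have "P x + r = P (x + y) + s" for x
    by (simp add: y P_add add.assoc)
  moreover have "P x + s = P (x - y) + r" for x
  proof -
    have "P x + s = P ((x - y) + y) + s"
      by simp
    thus ?thesis
      by (simp only: y P_add add.assoc)
  qed
  ultimately show "cls r = cls s"
    unfolding cls_def by (blast intro: range_eqI)
qed

lemma cls_add_P: "cls (r + P x) = cls r"
  unfolding cls_eq_iff P_central[symmetric] by blast

lemma cls_add_commute: "cls (r + s) = cls (s + r)"
  by (subst (2) add_swap) (simp only: cls_add_P)

lemma cls_mult_add_left: "cls ((r + s) * t) = cls (r * t + s * t)"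
  by (simp only: mult_add_left cls_add_P)

lemma a_r_coset_Re: "(range P) +>\<^bsub>Re\<^esub> r = cls r"
  by (auto simp: a_r_coset_def' Re_def cls_def)

lemma carrier_Rbar: "carrier Rbar = range cls"
  unfolding Rbar_def FactRing_def A_RCOSETS_def'
  by (auto simp: a_r_coset_Re) (auto simp: Re_def)

lemma one_Rbar: "\<one>\<^bsub>Rbar\<^esub> = cls 1"
  unfolding Rbar_def FactRing_def by (simp add: a_r_coset_Re) (simp add: Re_def)

lemma zero_Rbar: "\<zero>\<^bsub>Rbar\<^esub> = cls 0"
  unfolding Rbar_def FactRing_def by (simp add: cls_def)

lemma add_Rbar: "cls r \<oplus>\<^bsub>Rbar\<^esub> cls s = cls (r + s)"
proof -
  have eq: "(P x + r) + (P y + s) = P (x + y) + (r + s)" for x y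
  proof -
    have "(P x + r) + (P y + s) = P x + ((r + P y) + s)"
      by (simp only: add.assoc)
    also have "r + P y = P y + r"
      by (rule P_central[symmetric])
    finally show ?thesis
      by (simp only: P_add add.assoc)
  qed
  have "cls r \<oplus>\<^bsub>Rbar\<^esub> cls s = (\<Union>x y. {(P x + r) + (P y + s)})"
    unfolding Rbar_def FactRing_def by (auto simp: set_add_def' Re_def cls_def)
  also have "\<dots> = (\<Union>x y. {P (x + y) + (r + s)})"
    by (simp only: eq)
  also have "\<dots> = cls (r + s)"
  proof -
    have "P x + (r + s) \<in> (\<Union>x y. {P (x + y) + (r + s)})" for x
      by (rule UN_I[of x], simp, rule UN_I[of 0]) simp_all
    thus ?thesis
      unfolding cls_def by blast
  qed
  finally show ?thesis .
qed

lemma mult_P: "r * P x = P (act r r x 1)" and P_mult: "P x * r = P (act 1 1 x r)"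
  using P_act[of r x 1] P_act[of 1 x r] by simp_all

lemma cls_mult_cong: "cls ((P x + r) * (P y + s)) = cls (r * s)"
proof -
  let ?q = "P x + r"
  have "?q * (P y + s) = ?q * P y + ?q * s"
    by (rule mult_add_right)
  also have "?q * P y = P (act ?q ?q y 1)"
    by (rule mult_P)
  also have "?q * s = P (act 1 1 x s) + r * s"
    by (simp add: mult_add_left act_P_left1 P_mult)
  finally have "?q * (P y + s) = P (act ?q ?q y 1 + act 1 1 x s) + r * s"
    by (simp only: P_add add.assoc)
  thus ?thesis
    unfolding cls_eq_iff by blast
qed

lemma mult_Rbar: "cls r \<otimes>\<^bsub>Rbar\<^esub> cls s = cls (r * s)"
proof -
  have "cls r \<otimes>\<^bsub>Rbar\<^esub> cls s = (\<Union>x y. cls ((P x + r) * (P y + s)))"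
    unfolding Rbar_def FactRing_def
    by (auto simp: rcoset_mult_def a_r_coset_Re) (auto simp: Re_def cls_def)
  thus ?thesis
    by (simp add: cls_mult_cong)
qed

text \<open>So the library quotient, defined for arbitrary records, is indeed a ring here.\<close>

lemma ring_Rbar: "ring Rbar"
proof (rule ringI)
  show "abelian_group Rbar"
  proof (rule abelian_groupI; (unfold carrier_Rbar zero_Rbar)?)
    show "\<And>x y. \<lbrakk>x \<in> range cls; y \<in> range cls\<rbrakk> \<Longrightarrow> x \<oplus>\<^bsub>Rbar\<^esub> y = y \<oplus>\<^bsub>Rbar\<^esub> x"
      by (auto simp: add_Rbar cls_add_commute)
    show "\<And>x. x \<in> range cls \<Longrightarrow> \<exists>y\<in>range cls. y \<oplus>\<^bsub>Rbar\<^esub> x = cls 0"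
      by (auto simp: add_Rbar) (metis left_minus)
  qed (auto simp: add_Rbar add.assoc)
  show "Group.monoid Rbar"
    by (rule Group.monoidI) (auto simp: carrier_Rbar one_Rbar mult_Rbar mult.assoc)
  show "\<And>x y z. \<lbrakk>x \<in> carrier Rbar; y \<in> carrier Rbar; z \<in> carrier Rbar\<rbrakk>
        \<Longrightarrow> (x \<oplus>\<^bsub>Rbar\<^esub> y) \<otimes>\<^bsub>Rbar\<^esub> z = x \<otimes>\<^bsub>Rbar\<^esub> z \<oplus>\<^bsub>Rbar\<^esub> y \<otimes>\<^bsub>Rbar\<^esub> z"
    by (auto simp: carrier_Rbar add_Rbar mult_Rbar cls_mult_add_left)
  show "\<And>x y z. \<lbrakk>x \<in> carrier Rbar; y \<in> carrier Rbar; z \<in> carrier Rbar\<rbrakk>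
        \<Longrightarrow> z \<otimes>\<^bsub>Rbar\<^esub> (x \<oplus>\<^bsub>Rbar\<^esub> y) = z \<otimes>\<^bsub>Rbar\<^esub> x \<oplus>\<^bsub>Rbar\<^esub> z \<otimes>\<^bsub>Rbar\<^esub> y"
    by (auto simp: carrier_Rbar add_Rbar mult_Rbar mult_add_right)
qed

end

locale commutative_square_ring = square_ring +
  assumes cring_Rbar: "cring Rbar"
    and act_left_eq: "act r 1 x 1 = act 1 r x 1"
    and act_right_eq: "act 1 r x 1 = act 1 1 x r"

text \<open>In a module, \<open>scal m r\<close> stands for \<open>m \<cdot> r\<close> and \<open>brk m n x\<close> for \<open>[m,n] \<cdot> x\<close>.\<close>

locale bhp_module = square_ring act T H P
  for act :: "'e::{group_add, monoid_mult} \<Rightarrow> 'e \<Rightarrow> 'ee::ab_group_add \<Rightarrow> 'e \<Rightarrow> 'ee"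
    and T H P +
  fixes scal :: "'m::group_add \<Rightarrow> 'e \<Rightarrow> 'm"
    and brk :: "'m \<Rightarrow> 'm \<Rightarrow> 'ee \<Rightarrow> 'm"
  assumes scal_one: "scal m 1 = m"
    and scal_scal: "scal (scal m r) s = scal m (r * s)"
    and scal_add: "scal m (r + s) = scal m r + scal m s"
    and add_scal: "scal (m + n) r = scal m r + scal n r + brk m n (H r)"
    and scal_P: "scal m (P x) = brk m m x"
    and brk_T: "brk m n (T x) = brk n m x"
    and brk_add1: "brk (m + m') n x = brk m n x + brk m' n x"
    and brk_add2: "brk m (n + n') x = brk m n x + brk m n' x"
    and brk_add3: "brk m n (x + y) = brk m n x + brk m n y"
    and scal_brk: "scal (brk (scal m r) (scal n s) x) t = brk m n (act r s x t)"
    and brk_brk: "brk (brk m m' x) n y = 0"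

definition bhp_submodule ::
  "('m::group_add \<Rightarrow> 'e \<Rightarrow> 'm) \<Rightarrow> ('m \<Rightarrow> 'm \<Rightarrow> 'ee \<Rightarrow> 'm) \<Rightarrow> 'm set \<Rightarrow> bool"
  where "bhp_submodule scal brk S \<longleftrightarrow>
    0 \<in> S \<and> (\<forall>m\<in>S. \<forall>n\<in>S. m + n \<in> S) \<and> (\<forall>m\<in>S. - m \<in> S) \<and>
    (\<forall>m\<in>S. \<forall>r. scal m r \<in> S) \<and> (\<forall>m\<in>S. \<forall>n\<in>S. \<forall>x. brk m n x \<in> S)"

definition bhp_span ::
  "('m::group_add \<Rightarrow> 'e \<Rightarrow> 'm) \<Rightarrow> ('m \<Rightarrow> 'm \<Rightarrow> 'ee \<Rightarrow> 'm) \<Rightarrow> 'm set \<Rightarrow> 'm set"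
  where "bhp_span scal brk A = \<Inter>{S. bhp_submodule scal brk S \<and> A \<subseteq> S}"

definition bhp_bracket_submodule ::
  "('m::group_add \<Rightarrow> 'e \<Rightarrow> 'm) \<Rightarrow> ('m \<Rightarrow> 'm \<Rightarrow> 'ee \<Rightarrow> 'm) \<Rightarrow> 'm set"
  where "bhp_bracket_submodule scal brk = bhp_span scal brk {brk m n x | m n x. True}"

definition bhp_central :: "('m::group_add \<Rightarrow> 'm \<Rightarrow> 'ee \<Rightarrow> 'm) \<Rightarrow> 'm set \<Rightarrow> 'm \<Rightarrow> bool"
  where "bhp_central brk L u \<longleftrightarrow> u \<in> L \<and> (\<forall>v\<in>L. \<forall>x. brk u v x = 0)"

definition bhp_linear ::
  "('m::group_add \<Rightarrow> 'e \<Rightarrow> 'm) \<Rightarrow> ('m \<Rightarrow> 'm \<Rightarrow> 'ee \<Rightarrow> 'm) \<Rightarrow>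
   ('n::group_add \<Rightarrow> 'e \<Rightarrow> 'n) \<Rightarrow> ('n \<Rightarrow> 'n \<Rightarrow> 'ee \<Rightarrow> 'n) \<Rightarrow> ('m \<Rightarrow> 'n) \<Rightarrow> bool"
  where "bhp_linear scalM brkM scalN brkN g \<longleftrightarrow>
    (\<forall>m m'. g (m + m') = g m + g m') \<and>
    (\<forall>m r. g (scalM m r) = scalN (g m) r) \<and>
    (\<forall>m m' x. g (brkM m m' x) = brkN (g m) (g m') x)"

definition bhp_bilinear ::
  "('m::group_add \<Rightarrow> 'e \<Rightarrow> 'm) \<Rightarrow> ('m \<Rightarrow> 'm \<Rightarrow> 'ee \<Rightarrow> 'm) \<Rightarrow>
   ('n::group_add \<Rightarrow> 'e \<Rightarrow> 'n) \<Rightarrow> ('n \<Rightarrow> 'n \<Rightarrow> 'ee \<Rightarrow> 'n) \<Rightarrow> ('m \<Rightarrow> 'm \<Rightarrow> 'n) \<Rightarrow> bool"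
  where "bhp_bilinear scalM brkM scalN brkN b \<longleftrightarrow>
    (\<forall>m'. bhp_linear scalM brkM scalN brkN (\<lambda>m. b m m')) \<and>
    (\<forall>m. bhp_linear scalM brkM scalN brkN (\<lambda>m'. b m m'))"

definition add_defect :: "('m::group_add \<Rightarrow> 'n::group_add) \<Rightarrow> 'm \<Rightarrow> 'm \<Rightarrow> 'n"
  where "add_defect f m m' = f (m + m') - f m' - f m"

definition scal_defect ::
  "('m \<Rightarrow> 'e \<Rightarrow> 'm) \<Rightarrow> ('n::group_add \<Rightarrow> 'e \<Rightarrow> 'n) \<Rightarrow> ('m \<Rightarrow> 'n) \<Rightarrow> 'e \<Rightarrow> 'm \<Rightarrow> 'n"
  where "scal_defect scalM scalN f r m = f (scalM m r) - scalN (f m) r"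

definition brk_defect ::
  "('m \<Rightarrow> 'm \<Rightarrow> 'ee \<Rightarrow> 'm) \<Rightarrow> ('n::group_add \<Rightarrow> 'n \<Rightarrow> 'ee \<Rightarrow> 'n) \<Rightarrow> ('m \<Rightarrow> 'n) \<Rightarrow>
   'ee \<Rightarrow> 'm \<Rightarrow> 'm \<Rightarrow> 'n"
  where "brk_defect brkM brkN f x m m' = f (brkM m m' x) - brkN (f m) (f m') x"

definition bhp_quadratic ::
  "('m::group_add \<Rightarrow> 'e::monoid_mult \<Rightarrow> 'm) \<Rightarrow> ('m \<Rightarrow> 'm \<Rightarrow> 'ee \<Rightarrow> 'm) \<Rightarrow>
   ('n::group_add \<Rightarrow> 'e \<Rightarrow> 'n) \<Rightarrow> ('n \<Rightarrow> 'n \<Rightarrow> 'ee \<Rightarrow> 'n) \<Rightarrow> ('m \<Rightarrow> 'n) \<Rightarrow> bool"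
  where "bhp_quadratic scalM brkM scalN brkN f \<longleftrightarrow>
    (let L = bhp_span scalN brkN (range f) in
      (\<forall>u \<in> bhp_span scalN brkN {add_defect f m m' | m m'. True}. bhp_central brkN L u) \<and>
      (\<forall>r. \<forall>u \<in> bhp_span scalN brkN (range (scal_defect scalM scalN f r)).
        bhp_central brkN L u) \<and>
      (\<forall>x. \<forall>u \<in> bhp_span scalN brkN {brk_defect brkM brkN f x m m' | m m'. True}.
        bhp_central brkN L u)) \<and>
    bhp_bilinear scalM brkM scalN brkN (add_defect f) \<and>
    (\<forall>x. bhp_bilinear scalM brkM scalN brkN (brk_defect brkM brkN f x)) \<and>
    (\<forall>m r s. scal_defect scalM scalN f r (scalM m s) = scalN (scal_defect scalM scalN f r m) (s ^ 2))"

end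

(* All brackets of N annihilate brackets, so condition (1) says exactly that every defect of f
   annihilates f(M), which is the centrality condition (i). Given this and bilinearity of d_f,
   d_f vanishes as soon as one argument is a bracket. Hence f is additive on [M], and comparing
   f([m,n]x . r) with f([m,n]x) . r turns (4) into the compatibility of f_[x] with scalars,
   the only part of its bilinearity that is not automatic. *)

theory Submission
  imports Defs
begin

section \<open>Cancellation in groups that need not be commutative\<close>

lemma add_eq_self_iff:
  fixes a b :: "'a::group_add"
  shows "a + b = a \<longleftrightarrow> b = 0" "a = a + b \<longleftrightarrow> b = 0"
    "b + a = a \<longleftrightarrow> b = 0" "a = b + a \<longleftrightarrow> b = 0"
  using add_left_cancel[of a b 0] add_right_cancel[of b a 0] by auto

text \<open>Only \<open>c\<close> has to move past other terms. It will be a bracket, so that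
  differences of the form value minus bracket add up termwise.\<close>

lemma add_diff_add_eq_if_central:
  fixes a b c e :: "'a::group_add"
  assumes "\<And>z. c + z = z + c"
  shows "(a + b) - (c + e) = (a - c) + (b - e)"
proof -
  have "(a - c) + (b - e) + (c + e) = (a - c) + (c + ((b - e) + e))"
    by (simp only: assms add.assoc)
  also have "\<dots> = a + b"
    by (simp flip: add.assoc)
  finally show ?thesis
    by (metis add_diff_cancel)
qed

section \<open>Arithmetic in a module over a commutative square ring\<close>

locale commutative_bhp_module = bhp_module act T H P scal brk + commutative_square_ring act T H P
  for act :: "'e::{group_add, monoid_mult} \<Rightarrow> 'e \<Rightarrow> 'ee::ab_group_add \<Rightarrow> 'e \<Rightarrow> 'ee"
    and T H P and scal :: "'m::group_add \<Rightarrow> 'e \<Rightarrow> 'm" and brk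
begin

lemma brk_zero1 [simp]: "brk 0 n x = 0"
  using brk_add1[of 0 0 n x] by (simp add: add_eq_self_iff)

lemma brk_zero2 [simp]: "brk m 0 x = 0"
  using brk_add2[of m 0 0 x] by (simp add: add_eq_self_iff)

lemma brk_minus1: "brk (- m) n x = - brk m n x"
  using brk_add1[of "- m" m n x] by (simp add: eq_neg_iff_add_eq_0)

lemma brk_minus2: "brk m (- n) x = - brk m n x"
  using brk_add2[of m "- n" n x] by (simp add: eq_neg_iff_add_eq_0)

lemma brk_diff1: "brk (m - m') n x = brk m n x - brk m' n x"
  using brk_add1[of m "- m'" n x] by (simp add: brk_minus1)

lemma brk_diff2: "brk m (n - n') x = brk m n x - brk m n' x"
  using brk_add2[of m n "- n'" x] by (simp add: brk_minus2)

lemma brk_brk2: "brk m (brk n n' x) y = 0"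
  by (metis brk_T brk_brk)

lemma scal_brk_right: "scal (brk m n x) r = brk m n (act 1 1 x r)"
  using scal_brk[of m 1 n 1 x r] by (simp add: scal_one)

text \<open>Commutativity makes the three actions of \<open>r\<close> on \<open>x\<close> agree, so
  a scalar can pass from an argument of a bracket to the outside.\<close>

lemma brk_scal1: "brk (scal m r) n x = scal (brk m n x) r"
  using scal_brk[of m r n 1 x 1]
  by (simp add: scal_one scal_brk_right act_left_eq act_right_eq)

lemma brk_scal2: "brk m (scal n r) x = scal (brk m n x) r"
  using scal_brk[of m 1 n r x 1]
  by (simp add: scal_one scal_brk_right act_right_eq)

lemma zero_scal [simp]: "scal 0 r = 0"
  using add_scal[of 0 0 r] by (simp add: add_eq_self_iff)

text \<open>Expanding the scaling of \<open>- m + m\<close> leaves the correction term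
  \<open>brk (- m) m (H r)\<close>, which is a negated self-bracket of \<open>m\<close>.\<close>

lemma minus_scal: "(\<And>x. brk m m x = 0) \<Longrightarrow> scal (- m) r = - scal m r"
  using add_scal[of "- m" m r] by (simp add: brk_minus1 eq_neg_iff_add_eq_0)

lemma brk_central: "brk m n x + z = z + brk m n x"
proof -
  let ?u = "brk m n x"
  \<comment> \<open>Both sides compute \<open>scal (?u + z) (1 + 1)\<close>: \<open>scal_add\<close>
    splits the scalar, while \<open>add_scal\<close> splits the sum with a correction that vanishes
    because \<open>?u\<close> is a bracket. Cancelling the outer terms leaves the
    commutation.\<close>
  have "(?u + z) + (?u + z) = (?u + ?u) + (z + z)"
    using add_scal[of ?u z "1 + 1"] by (simp only: scal_add scal_one brk_brk add_0_right)
  hence "z + ?u + z = ?u + z + z"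
    by (simp add: add.assoc)
  thus ?thesis
    by (metis add_right_imp_eq)
qed

text \<open>Scaling is not additive in general, but here the correction pairs \<open>a\<close> with
  a bracket and is zero.\<close>

lemma diff_brk_scal: "scal (a - brk m n x) r = scal a r - scal (brk m n x) r"
  using add_scal[of a "- brk m n x" r]
  by (simp add: brk_minus2 brk_brk2 minus_scal brk_brk)

lemma diff_brk_add_distrib:
  "(a + b) - (brk m n x + e) = (a - brk m n x) + (b - e)"
  by (rule add_diff_add_eq_if_central) (rule brk_central)

section \<open>Submodules, spans and central elements\<close>

lemma bhp_submodule_span: "bhp_submodule scal brk (bhp_span scal brk A)"
  unfolding bhp_span_def bhp_submodule_def by auto

lemma bhp_span_superset: "a \<in> A \<Longrightarrow> a \<in> bhp_span scal brk A"
  unfolding bhp_span_def by auto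

lemma bhp_span_minimal: "bhp_submodule scal brk S \<Longrightarrow> A \<subseteq> S \<Longrightarrow> bhp_span scal brk A \<subseteq> S"
  unfolding bhp_span_def by auto

lemma bhp_submodule_annihilator: "bhp_submodule scal brk {v. \<forall>x. brk u v x = 0}"
  unfolding bhp_submodule_def by (auto simp: brk_add2 brk_minus2 brk_scal2 brk_brk2)

lemma bhp_submodule_central:
  assumes "bhp_submodule scal brk L"
  shows "bhp_submodule scal brk (Collect (bhp_central brk L))"
  using assms unfolding bhp_submodule_def bhp_central_def
  by (auto simp: brk_add1 brk_minus1 brk_scal1 brk_brk)

text \<open>Centrality is tested on generators by using minimality of spans twice: the annihilator
  of a fixed \<open>a\<close> is a submodule containing \<open>B\<close>, and the central elements
  then form a submodule containing \<open>A\<close>.\<close>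

lemma span_bhp_central_iff:
  assumes "A \<subseteq> bhp_span scal brk B"
  shows "(\<forall>u \<in> bhp_span scal brk A. bhp_central brk (bhp_span scal brk B) u) \<longleftrightarrow>
    (\<forall>a\<in>A. \<forall>b\<in>B. \<forall>x. brk a b x = 0)" (is "?L \<longleftrightarrow> ?R")
proof
  assume ?L
  thus ?R
    by (auto simp: bhp_central_def bhp_span_superset)
next
  assume R: ?R
  have "bhp_central brk (bhp_span scal brk B) a" if "a \<in> A" for a
    using bhp_span_minimal[OF bhp_submodule_annihilator[of a], of B] R assms that
    by (auto simp: bhp_central_def)
  thus ?L
    using bhp_span_minimal[OF bhp_submodule_central[OF bhp_submodule_span], of A B] by auto
qed

end

section \<open>The defects of a map and their centrality\<close>

locale commutative_bhp_map =
  M: commutative_bhp_module act T H P scalM brkM + N: commutative_bhp_module act T H P scalN brkN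
  for act :: "'e::{group_add, monoid_mult} \<Rightarrow> 'e \<Rightarrow> 'ee::ab_group_add \<Rightarrow> 'e \<Rightarrow> 'ee"
    and T H P
    and scalM :: "'m::group_add \<Rightarrow> 'e \<Rightarrow> 'm" and brkM
    and scalN :: "'n::group_add \<Rightarrow> 'e \<Rightarrow> 'n" and brkN +
  fixes f :: "'m \<Rightarrow> 'n"
begin

abbreviation "ddef \<equiv> add_defect f"
abbreviation "sdef \<equiv> scal_defect scalM scalN f"
abbreviation "bdef \<equiv> brk_defect brkM brkN f"
abbreviation "span_f \<equiv> bhp_span scalN brkN (range f)"

lemma f_add: "f (m + m') = ddef m m' + f m + f m'"
  by (simp add: add_defect_def)

lemma f_scal: "f (scalM m r) = sdef r m + scalN (f m) r"
  by (simp add: scal_defect_def)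

lemma f_brk: "f (brkM m m' x) = bdef x m m' + brkN (f m) (f m') x"
  by (simp add: brk_defect_def)

lemma span_f_closed:
  "f m \<in> span_f"
  "a \<in> span_f \<Longrightarrow> b \<in> span_f \<Longrightarrow> a - b \<in> span_f"
  "a \<in> span_f \<Longrightarrow> scalN a r \<in> span_f"
  "a \<in> span_f \<Longrightarrow> b \<in> span_f \<Longrightarrow> brkN a b x \<in> span_f"
  using N.bhp_span_superset[of "f m" "range f"] N.bhp_submodule_span[of "range f"]
  by (auto simp: bhp_submodule_def diff_conv_add_uminus simp del: add_uminus_conv_diff)

lemma defects_in_span_f: "ddef m m' \<in> span_f" "sdef r m \<in> span_f" "bdef x m m' \<in> span_f"
  by (simp_all add: add_defect_def scal_defect_def brk_defect_def span_f_closed)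

text \<open>After reduction to generators, each kind of defect corresponds to one clause of
  linearity: inserting \<open>f_add\<close>, \<open>f_scal\<close> or \<open>f_brk\<close> into a
  bracket with \<open>f n\<close> leaves the bracket of the defect as the only surplus term.\<close>

lemma central_defects_iff:
  "(\<forall>u \<in> bhp_span scalN brkN {ddef m m' | m m'. True}. bhp_central brkN span_f u) \<and>
   (\<forall>r. \<forall>u \<in> bhp_span scalN brkN (range (sdef r)). bhp_central brkN span_f u) \<and>
   (\<forall>x. \<forall>u \<in> bhp_span scalN brkN {bdef x m m' | m m'. True}. bhp_central brkN span_f u)
   \<longleftrightarrow> (\<forall>n \<in> range f. \<forall>x. bhp_linear scalM brkM scalN brkN (\<lambda>m. brkN (f m) n x))"
  (is "?L \<longleftrightarrow> ?R")
proof -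
  have "?L \<longleftrightarrow> (\<forall>m m' n x. brkN (ddef m m') (f n) x = 0) \<and>
      (\<forall>r m n x. brkN (sdef r m) (f n) x = 0) \<and>
      (\<forall>y m m' n x. brkN (bdef y m m') (f n) x = 0)"
  proof (intro arg_cong2[where f = "(\<and>)"])
    show "(\<forall>u \<in> bhp_span scalN brkN {ddef m m' | m m'. True}. bhp_central brkN span_f u) \<longleftrightarrow>
        (\<forall>m m' n x. brkN (ddef m m') (f n) x = 0)"
      by (subst N.span_bhp_central_iff) (auto simp: defects_in_span_f)
    have "(\<forall>u \<in> bhp_span scalN brkN (range (sdef r)). bhp_central brkN span_f u) \<longleftrightarrow>
        (\<forall>m n x. brkN (sdef r m) (f n) x = 0)" for r
      by (subst N.span_bhp_central_iff) (auto simp: defects_in_span_f)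
    thus "(\<forall>r. \<forall>u \<in> bhp_span scalN brkN (range (sdef r)). bhp_central brkN span_f u) \<longleftrightarrow>
        (\<forall>r m n x. brkN (sdef r m) (f n) x = 0)"
      by simp
    have "(\<forall>u \<in> bhp_span scalN brkN {bdef y m m' | m m'. True}. bhp_central brkN span_f u) \<longleftrightarrow>
        (\<forall>m m' n x. brkN (bdef y m m') (f n) x = 0)" for y
      by (subst N.span_bhp_central_iff) (auto simp: defects_in_span_f)
    thus "(\<forall>y. \<forall>u \<in> bhp_span scalN brkN {bdef y m m' | m m'. True}. bhp_central brkN span_f u)
        \<longleftrightarrow> (\<forall>y m m' n x. brkN (bdef y m m') (f n) x = 0)"
      by simp
  qed
  also have "\<dots> \<longleftrightarrow> ?R"
  proof -
    have "brkN (ddef m m') (f n) x = 0 \<longleftrightarrow>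
        brkN (f (m + m')) (f n) x = brkN (f m) (f n) x + brkN (f m') (f n) x" for m m' n x
      by (simp add: f_add N.brk_add1 add.assoc add_eq_self_iff)
    moreover have "brkN (sdef r m) (f n) x = 0 \<longleftrightarrow>
        brkN (f (scalM m r)) (f n) x = scalN (brkN (f m) (f n) x) r" for r m n x
      by (simp add: f_scal N.brk_add1 N.brk_scal1 add_eq_self_iff)
    \<comment> \<open>Nested brackets vanish, so both the right-hand side and the bracket part of
      \<open>f_brk\<close> contribute zero.\<close>
    moreover have "brkN (bdef y m m') (f n) x = 0 \<longleftrightarrow>
        brkN (f (brkM m m' y)) (f n) x = brkN (brkN (f m) (f n) x) (brkN (f m') (f n) x) y"
      for y m m' n x
      by (simp add: f_brk N.brk_add1 N.brk_brk)
    ultimately show ?thesis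
      unfolding bhp_linear_def by (simp only: ball_simps) blast
  qed
  finally show ?thesis .
qed

text \<open>Reduces linearity in the second argument to linearity in the first.\<close>

lemma bdef_swap: "bdef x m m' = bdef (T x) m' m"
  by (simp add: brk_defect_def M.brk_T N.brk_T)

section \<open>Consequences of conditions (1) and (2)\<close>

context
  assumes lin: "\<And>n x. bhp_linear scalM brkM scalN brkN (\<lambda>m. brkN (f m) (f n) x)"
    and bilin: "bhp_bilinear scalM brkM scalN brkN ddef"
begin

lemma brk_f_add: "brkN (f (m + m')) (f n) x = brkN (f m) (f n) x + brkN (f m') (f n) x"
  using lin by (simp add: bhp_linear_def)

lemma brk_f_scal: "brkN (f (scalM m r)) (f n) x = scalN (brkN (f m) (f n) x) r"
  using lin by (simp add: bhp_linear_def)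

lemma brk_f_brk: "brkN (f (brkM m m' y)) (f n) x = 0"
  using lin by (simp add: bhp_linear_def N.brk_brk)

lemma brk_ddef_f: "brkN (ddef m m') (f n) x = 0"
  using brk_f_add[of m m' n x] by (simp add: f_add N.brk_add1 add.assoc add_eq_self_iff)

lemma brk_bdef_f: "brkN (bdef y m m') (f n) x = 0"
  by (simp add: brk_defect_def N.brk_diff1 brk_f_brk N.brk_brk)

text \<open>One defect is annihilated by all values of \<open>f\<close>, and the other is a
  combination of such values.\<close>

lemma brk_ddef_ddef: "brkN (ddef m m') (ddef n n') x = 0"
  by (subst (2) add_defect_def) (simp add: N.brk_diff2 brk_ddef_f)

lemma brk_bdef_bdef: "brkN (bdef y m m') (bdef z n n') x = 0"
  by (subst (2) brk_defect_def) (simp add: N.brk_diff2 brk_bdef_f N.brk_brk2)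

lemma ddef_zero1: "ddef 0 v = 0"
proof -
  have "ddef (0 + 0) v = ddef 0 v + ddef 0 v"
    using bilin by (simp only: bhp_bilinear_def bhp_linear_def)
  thus ?thesis
    by (simp add: add_eq_self_iff)
qed

lemma ddef_add1: "ddef (u + u') v = ddef u v + ddef u' v"
  using bilin by (simp add: bhp_bilinear_def bhp_linear_def)

lemma ddef_scal1: "ddef (scalM u r) v = scalN (ddef u v) r"
  using bilin by (simp add: bhp_bilinear_def bhp_linear_def)

text \<open>Linearity turns the left-hand side into a bracket of two additive defects, which is
  zero.\<close>

lemma ddef_brk1: "ddef (brkM m n x) v = 0"
  using bilin by (simp add: bhp_bilinear_def bhp_linear_def brk_ddef_ddef)

lemma f_zero: "f 0 = 0"
  using ddef_zero1[of 0] f_add[of 0 0] by (simp add: add_eq_self_iff)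

text \<open>The scalar \<open>r\<close> acts on \<open>brkM m n x\<close> either outside or through
  \<open>m\<close>. The assumption compares the two after applying \<open>f\<close>, and the common
  term \<open>scalN (brkN (f m) (f n) x) r\<close> cancels.\<close>

lemma sdef_eq_0_if_bdef_scal:
  assumes "\<And>x m n r. bdef x (scalM m r) n = scalN (bdef x m n) r"
  shows "sdef r (brkM m n x) = 0"
proof -
  have "f (scalM (brkM m n x) r) - scalN (brkN (f m) (f n) x) r = bdef x (scalM m r) n"
    by (simp add: brk_defect_def M.brk_scal1 brk_f_scal)
  also have "\<dots> = scalN (f (brkM m n x)) r - scalN (brkN (f m) (f n) x) r"
    by (simp add: assms) (simp add: brk_defect_def N.diff_brk_scal)
  finally show ?thesis
    by (simp add: scal_defect_def) (metis diff_add_cancel)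
qed

text \<open>The extra conjuncts make the scalar condition stable under addition and negation.\<close>

lemma bhp_submodule_regular:
  "bhp_submodule scalM brkM
    {u. (\<forall>r. f (scalM u r) = scalN (f u) r) \<and> (\<forall>v. ddef u v = 0) \<and>
        (\<forall>v y. brkN (f u) (f v) y = 0) \<and> (\<forall>v y. brkM u v y = 0)}" (is "bhp_submodule _ _ ?S")
  unfolding bhp_submodule_def
proof (intro conjI ballI allI)
  show "0 \<in> ?S"
    by (simp add: f_zero ddef_zero1)
  show "u + v \<in> ?S" if "u \<in> ?S" "v \<in> ?S" for u v
    using that
    by (simp add: ddef_add1 f_add N.brk_add1 M.brk_add1 M.add_scal N.add_scal ddef_scal1)
  show "- u \<in> ?S" if u: "u \<in> ?S" for u
  proof -
    \<comment> \<open>Here \<open>ddef w (- w) = 0\<close> and \<open>f 0 = 0\<close>, so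
      \<open>f w + f (- w) = 0\<close>.\<close>
    have neg: "f (- w) = - f w" if "\<And>v. ddef w v = 0" for w
      using f_add[of w "- w"] that by (simp add: f_zero minus_unique)
    \<comment> \<open>This lets \<open>neg\<close> apply to \<open>scalM u r\<close>, whose negative
      is \<open>scalM (- u) r\<close>.\<close>
    have "ddef (scalM u r) v = 0" for r v
      using u by (simp add: ddef_scal1)
    moreover have "ddef (- u) v = 0" for v
      using ddef_add1[of "- u" u v] u by (simp add: ddef_zero1)
    ultimately show ?thesis
      using u by (simp add: neg M.minus_scal N.minus_scal M.brk_minus1 N.brk_minus1)
  qed
  show "scalM u r \<in> ?S" if "u \<in> ?S" for u r
    using that by (simp add: M.scal_scal N.scal_scal ddef_scal1 N.brk_scal1 M.brk_scal1)
  show "brkM u v x \<in> ?S" if "u \<in> ?S" "v \<in> ?S" for u v x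
    using that by (simp add: f_zero ddef_zero1)
qed

lemma sdef_bracket_eq_0_iff_bdef_bilinear:
  "(\<forall>r. \<forall>m \<in> bhp_bracket_submodule scalM brkM. sdef r m = 0) \<longleftrightarrow>
   (\<forall>x. bhp_bilinear scalM brkM scalN brkN (bdef x))" (is "?L \<longleftrightarrow> ?R")
proof
  assume L: ?L
  \<comment> \<open>\<open>f\<close> splits the sum of two brackets by \<open>ddef_brk1\<close>, and
    centrality of brackets in the target allows the regrouping.\<close>
  have add: "bdef x (m + m') n = bdef x m n + bdef x m' n" for x m m' n
    by (simp add: brk_defect_def M.brk_add1 brk_f_add f_add[of "brkM m n x"] ddef_brk1
        N.diff_brk_add_distrib)
  have scal: "bdef x (scalM m r) n = scalN (bdef x m n) r" for x m n r
  proof -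
    have "sdef r (brkM m n x) = 0"
      using L M.bhp_span_superset[of "brkM m n x" "{brkM m n x | m n x. True}"]
      unfolding bhp_bracket_submodule_def by auto
    thus ?thesis
      by (simp add: brk_defect_def scal_defect_def M.brk_scal1 brk_f_scal N.diff_brk_scal)
  qed
  \<comment> \<open>Both sides are zero: the left one involves only nested brackets,
    \<open>f 0\<close> and a bracket killed by \<open>brk_f_brk\<close>.\<close>
  have brk: "bdef x (brkM m m' y) n = brkN (bdef x m n) (bdef x m' n) y" for x m m' n y
    unfolding brk_bdef_bdef by (simp add: brk_defect_def M.brk_brk f_zero brk_f_brk)
  have left: "bhp_linear scalM brkM scalN brkN (\<lambda>m. bdef x m n)" for x n
    by (simp add: bhp_linear_def add scal brk)
  moreover have "bhp_linear scalM brkM scalN brkN (\<lambda>n. bdef x m n)" for x m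
    using left[of "T x" m] by (simp only: bdef_swap[of x m])
  ultimately show ?R
    by (simp add: bhp_bilinear_def)
next
  assume R: ?R
  have "sdef r (brkM m n x) = 0" for r m n x
    by (rule sdef_eq_0_if_bdef_scal) (use R in \<open>simp add: bhp_bilinear_def bhp_linear_def\<close>)
  hence "f (scalM (brkM m n x) r) = scalN (f (brkM m n x)) r" for r m n x
    by (simp add: scal_defect_def)
  \<comment> \<open>The generators also satisfy the extra conjuncts, so the submodule of
    \<open>bhp_submodule_regular\<close> contains their whole span.\<close>
  hence "{brkM m n x | m n x. True} \<subseteq>
      {u. (\<forall>r. f (scalM u r) = scalN (f u) r) \<and> (\<forall>v. ddef u v = 0) \<and>
        (\<forall>v y. brkN (f u) (f v) y = 0) \<and> (\<forall>v y. brkM u v y = 0)}"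
    by (auto simp: ddef_brk1 brk_f_brk M.brk_brk)
  note M.bhp_span_minimal[OF bhp_submodule_regular this]
  thus ?L
    unfolding bhp_bracket_submodule_def scal_defect_def by fastforce
qed

end

end

theorem mainTheorem10:
  fixes act :: "'e::{group_add, monoid_mult} \<Rightarrow> 'e \<Rightarrow> 'ee::ab_group_add \<Rightarrow> 'e \<Rightarrow> 'ee"
    and T :: "'ee \<Rightarrow> 'ee" and H :: "'e \<Rightarrow> 'ee" and P :: "'ee \<Rightarrow> 'e"
    and scalM :: "'m::group_add \<Rightarrow> 'e \<Rightarrow> 'm" and brkM :: "'m \<Rightarrow> 'm \<Rightarrow> 'ee \<Rightarrow> 'm"
    and scalN :: "'n::group_add \<Rightarrow> 'e \<Rightarrow> 'n" and brkN :: "'n \<Rightarrow> 'n \<Rightarrow> 'ee \<Rightarrow> 'n"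
    and f :: "'m \<Rightarrow> 'n"
  assumes "commutative_square_ring act T H P"
    and "bhp_module act T H P scalM brkM"
    and "bhp_module act T H P scalN brkN"
  shows "bhp_quadratic scalM brkM scalN brkN f \<longleftrightarrow>
    (\<forall>n \<in> range f. \<forall>x. bhp_linear scalM brkM scalN brkN (\<lambda>m. brkN (f m) n x)) \<and>
    bhp_bilinear scalM brkM scalN brkN (add_defect f) \<and>
    (\<forall>m r s. scal_defect scalM scalN f r (scalM m s)
      = scalN (scal_defect scalM scalN f r m) (s ^ 2)) \<and>
    (\<forall>r. \<forall>m \<in> bhp_bracket_submodule scalM brkM. scal_defect scalM scalN f r m = 0)"
proof -
  interpret commutative_bhp_map act T H P scalM brkM scalN brkN f
    using assms by (simp add: commutative_bhp_map_def commutative_bhp_module_def)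
  \<comment> \<open>Condition (4) may be exchanged for bilinearity of the bracket defects under (1)
    and (2). Once (i) is rewritten as (1), both descriptions contain these two, and the rest is
    propositional.\<close>
  have "(\<forall>r. \<forall>m \<in> bhp_bracket_submodule scalM brkM. sdef r m = 0) \<longleftrightarrow>
      (\<forall>x. bhp_bilinear scalM brkM scalN brkN (bdef x))"
    if "\<forall>n \<in> range f. \<forall>x. bhp_linear scalM brkM scalN brkN (\<lambda>m. brkN (f m) n x)"
      and "bhp_bilinear scalM brkM scalN brkN ddef"
    using that by (intro sdef_bracket_eq_0_iff_bdef_bilinear) simp_all
  thus ?thesis
    unfolding bhp_quadratic_def Let_def central_defects_iff by argo
qed

end
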